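(* Assume $\|\partial_0 f\|<1$, and let $R$, $D_a(0)$ and the sets $M_p$ ($p\in\mathbb{N}$) be as defined in the context. Then: (a) $M_p\subset D_a(0)$ for any $p\geq 0$; (b) for any $p\geq 0$, $M_p$ is invariant to $f$, i.e. $f(M_p)\subset M_p$; (c) $M_p\subset M_{p+1}$ for any $p\geq 0$; (d) for any $x\in D_a(0)$ there exists $p^x\geq 0$ such that $x\in M_{p^x}$.
   Context: Let $\Omega\subset\mathbb{R}^n$ be a domain (open connected set) with $0\in\Omega$, and let $f:\Omega\to\Omega$ be an $\mathbb{R}$-analytic function with $f(0)=0$. Write $f^k$ for the $k$-th iterate of $f$ ($f^0=\mathrm{id}$), $\|\cdot\|$ for the Euclidean norm on $\mathbb{R}^n$ and for the induced operator norm on matrices, $\partial_0 f$ for the Jacobian matrix of $f$ at $0$, and $B(r)=\{x\in\mathbb{R}^n:\|x\|<r\}$ for $r>0$. Here $\mathbb{N}=\{0,1,2,\dots\}$. The domain of attraction of $0$ is $D_a(0)=\{x\in\Omega: f^k(x)\to 0 \text{ as } k\to\infty\}$. Standing assumption: $\|\partial_0 f\|<1$; under this assumption there is $r>0$ with $B(r)\subset\Omega$ and $\|f(x)\|<\|x\|$ for all $x\in B(r)\setminus\{0\}$. Let $R>0$ be the largest number such that $B(R)\subset\Omega$ and $\|f(x)\|<\|x\|$ for any $x\in B(R)\setminus\{0\}$; if every $r>0$ has this property, then $R=+\infty$ and $B(R)=\Omega=\mathbb{R}^n$. For an integer $p\geq 0$ put $M_p=f^{-p}(B(R))=\{x\in\Omega: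 f^p(x)\in B(R)\}$. *)

theory Defs
  imports "HOL-Analysis.Analysis"
begin

text \<open>
  Real-analytic maps in several variables: around every point of the set the map is the sum of a
  multivariate power series. Multi-indices are functions \<open>'n \<Rightarrow> nat\<close>; summation over them is
  unordered, which in finite dimension is absolute convergence. The expansion is required on a
  full ball, so for a set that is not open this means analyticity on a neighbourhood of it.
\<close>

definition real_analytic_on :: "(real ^ 'n \<Rightarrow> real ^ 'm) \<Rightarrow> (real ^ 'n) set \<Rightarrow> bool" where
  "real_analytic_on f S \<longleftrightarrow>
     (\<forall>a\<in>S. \<exists>r>0. \<exists>c :: ('n \<Rightarrow> nat) \<Rightarrow> real ^ 'm. \<forall>x\<in>ball a r.
        ((\<lambda>\<alpha>. (\<Prod>i\<in>UNIV. (x $ i - a $ i) ^ \<alpha> i) *\<^sub>R c \<alpha>) has_sum f x) UNIV)"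

definition domain_of_attraction ::
  "(real ^ 'n) set \<Rightarrow> (real ^ 'n \<Rightarrow> real ^ 'n) \<Rightarrow> (real ^ 'n) set" where
  "domain_of_attraction \<Omega> f = {x \<in> \<Omega>. (\<lambda>k. (f ^^ k) x) \<longlonglongrightarrow> 0}"

text \<open>Radii are extended reals, so that the radius \<open>\<infinity>\<close> gives the whole space.\<close>

definition eball0 :: "ereal \<Rightarrow> (real ^ 'n) set" where
  "eball0 r = {x. ereal (norm x) < r}"

definition contraction_radius ::
  "(real ^ 'n) set \<Rightarrow> (real ^ 'n \<Rightarrow> real ^ 'n) \<Rightarrow> ereal \<Rightarrow> bool" where
  "contraction_radius \<Omega> f r \<longleftrightarrow>
     0 < r \<and> eball0 r \<subseteq> \<Omega> \<and> (\<forall>x \<in> eball0 r - {0}. norm (f x) < norm x)"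

lemma contraction_radius_infinity:
  "contraction_radius \<Omega> f \<infinity> \<longleftrightarrow> (\<forall>r>0. contraction_radius \<Omega> f (ereal r))"
proof
  assume "\<forall>r>0. contraction_radius \<Omega> f (ereal r)"
  then have *: "contraction_radius \<Omega> f (ereal (norm x + 1))" for x :: "real ^ 'a"
    by (simp add: add_nonneg_pos)
  have "x \<in> \<Omega> \<and> (x \<noteq> 0 \<longrightarrow> norm (f x) < norm x)" for x
    using *[of x] by (auto simp: contraction_radius_def eball0_def subset_eq)
  then show "contraction_radius \<Omega> f \<infinity>"
    by (auto simp: contraction_radius_def)
qed (auto simp: contraction_radius_def eball0_def)

definition max_contraction_radius ::
  "(real ^ 'n) set \<Rightarrow> (real ^ 'n \<Rightarrow> real ^ 'n) \<Rightarrow> ereal" where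
  "max_contraction_radius \<Omega> f = (GREATEST r. contraction_radius \<Omega> f r)"

definition preimage_ball ::
  "(real ^ 'n) set \<Rightarrow> (real ^ 'n \<Rightarrow> real ^ 'n) \<Rightarrow> nat \<Rightarrow> (real ^ 'n) set" where
  "preimage_ball \<Omega> f p = {x \<in> \<Omega>. (f ^^ p) x \<in> eball0 (max_contraction_radius \<Omega> f)}"

end

theory Submission
  imports Defs
begin

text \<open>
  Analyticity enters only through differentiability: on a small ball a multivariate power series
  differs from its part of degree at most one by a quantity of order \<open>norm (x - a)\<^sup>2\<close>, so an
  analytic map is differentiable, and in particular continuous, at every point. Since the
  derivative at \<open>0\<close> has operator norm below \<open>1\<close>, some ball around \<open>0\<close> is contracted towards the
  origin, and since a ball of radius \<open>Sup A\<close> is the union of the balls with radius in \<open>A\<close>, there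
  is a largest such ball \<open>B(R)\<close>.

  The ball \<open>B(R)\<close> is mapped into itself, which gives the invariance and the monotonicity of its
  iterated preimages. Conversely, an orbit that tends to \<open>0\<close> has to enter the neighbourhood
  \<open>B(R)\<close> of \<open>0\<close>. The remaining point is that orbits in \<open>B(R)\<close> tend to \<open>0\<close>, although \<open>f\<close>
  decreases norms on \<open>B(R)\<close> without a uniform rate. Along such an orbit the norms decrease; if their limit
  were positive, the orbit would stay in a compact shell, on which the continuous function
  \<open>norm x - norm (f x)\<close> has a positive minimum, and the norms would drop by at least that amount
  at every step (lemma \<open>iterates_tendsto_0_of_norm_decreasing\<close>).
\<close>

section \<open>Differentiability of real-analytic maps\<close>

text \<open>Summability passes to the finitely many coordinates, and for real-valued families it is
  the same as absolute summability.\<close>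

lemma summable_on_imp_abs_summable_on_euclidean:
  fixes g :: "'i \<Rightarrow> 'a :: euclidean_space"
  assumes "g summable_on A"
  shows "(\<lambda>x. norm (g x)) summable_on A"
proof -
  have coord: "(\<lambda>x. \<bar>g x \<bullet> b\<bar>) summable_on A" for b
  proof -
    have "(\<lambda>x. g x \<bullet> b) summable_on A"
      using summable_on_bounded_linear[OF bounded_linear_inner_left assms] .
    then show ?thesis
      by (subst (asm) summable_on_iff_abs_summable_on_real) simp
  qed
  have "(\<lambda>x. \<Sum>b\<in>B. \<bar>g x \<bullet> b\<bar>) summable_on A" if "finite B" for B
    using that by induction (simp_all add: coord summable_on_add)
  from this[OF finite_Basis] have "(\<lambda>x. \<Sum>b\<in>Basis. \<bar>g x \<bullet> b\<bar>) summable_on A" .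
  then show ?thesis
    by (rule summable_on_comparison_test) (simp_all add: norm_le_l1)
qed

lemma has_derivative_zero_of_quadratic_bound:
  fixes f :: "'a::real_normed_vector \<Rightarrow> 'b::real_normed_vector"
  assumes "0 < t" and bound: "\<And>x. norm (x - a) < t \<Longrightarrow> norm (f x - f a) \<le> K * (norm (x - a))\<^sup>2"
  shows "(f has_derivative (\<lambda>_. 0)) (at a)"
proof (rule has_derivativeI_sandwich[where H = "\<lambda>x. K * norm (x - a)", OF \<open>0 < t\<close>])
  fix x assume "x \<noteq> a" "dist x a < t"
  then show "norm (f x - f a - 0) / norm (x - a) \<le> K * norm (x - a)"
    using bound[of x] by (simp add: dist_norm divide_simps power2_eq_square mult.assoc)
next
  have "((\<lambda>x. K * norm (x - a)) \<longlongrightarrow> K * norm (a - a)) (at a)"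
    by (intro tendsto_intros)
  then show "((\<lambda>x. K * norm (x - a)) \<longlongrightarrow> 0) (at a)" by simp
qed simp

lemma finite_multiindices_degree_le_1: "finite {\<alpha> :: 'n::finite \<Rightarrow> nat. sum \<alpha> UNIV \<le> 1}"
proof (rule finite_subset)
  show "{\<alpha> :: 'n \<Rightarrow> nat. sum \<alpha> UNIV \<le> 1} \<subseteq> PiE UNIV (\<lambda>_. {..1})"
  proof
    fix \<alpha> :: "'n \<Rightarrow> nat" assume "\<alpha> \<in> {\<alpha>. sum \<alpha> UNIV \<le> 1}"
    then have "\<alpha> i \<le> 1" for i
      using member_le_sum[of i UNIV \<alpha>] by simp
    then show "\<alpha> \<in> PiE UNIV (\<lambda>_. {..1})" by auto
  qed
qed (simp add: finite_PiE)

lemma monomial_le_norm_power: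
  fixes h :: "real ^ 'n"
  shows "\<bar>\<Prod>i\<in>UNIV. h $ i ^ \<alpha> i\<bar> \<le> norm h ^ sum \<alpha> UNIV"
  unfolding abs_prod power_sum
  by (intro prod_mono) (auto simp: power_abs intro!: power_mono component_le_norm_cart)

text \<open>Absolute convergence at the point whose coordinates all equal \<open>t\<close> bounds
  \<open>\<Sum>\<alpha>. t ^ \<bar>\<alpha>\<bar> * norm (c \<alpha>)\<close>. For \<open>norm h \<le> t\<close> every term of degree at least two is at most
  \<open>(norm h / t)\<^sup>2\<close> times the corresponding term of this sum, so only the finitely many terms of
  degree at most one matter for the derivative.\<close>

lemma differentiable_of_multivariate_power_series:
  fixes f :: "real ^ 'n \<Rightarrow> real ^ 'm" and c :: "('n \<Rightarrow> nat) \<Rightarrow> real ^ 'm"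
  assumes "0 < r"
    and series: "\<And>x. x \<in> ball a r \<Longrightarrow>
      ((\<lambda>\<alpha>. (\<Prod>i\<in>UNIV. (x $ i - a $ i) ^ \<alpha> i) *\<^sub>R c \<alpha>) has_sum f x) UNIV"
  shows "f differentiable (at a)"
proof -
  \<comment> \<open>small enough for the point \<open>a + u\<close> with all coordinates of \<open>u\<close> equal to \<open>t\<close> to lie in the ball\<close>
  define t where "t = r / (2 * CARD('n))"
  have t: "0 < t" using \<open>0 < r\<close> by (simp add: t_def)
  define u :: "real ^ 'n" where "u = (\<chi> i. t)"
  have "norm u \<le> (\<Sum>i\<in>UNIV. \<bar>u $ i\<bar>)" by (rule norm_le_l1_cart)
  also have "\<dots> = r / 2" using t by (simp add: u_def) (simp add: t_def)
  finally have u: "norm u < r" using \<open>0 < r\<close> by simp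
  have tr: "t < r"
    using component_le_norm_cart[of u undefined] u t by (simp add: u_def)

  define T where "T = (\<lambda>x \<alpha>. (\<Prod>i\<in>UNIV. (x $ i - a $ i) ^ \<alpha> i) *\<^sub>R c \<alpha>)"
  define F where "F = {\<alpha> :: 'n \<Rightarrow> nat. sum \<alpha> UNIV \<le> 1}"
  define C where "C = (\<Sum>\<^sub>\<infinity>\<alpha>\<in>-F. t ^ sum \<alpha> UNIV * norm (c \<alpha>))"
  have finF: "finite F"
    unfolding F_def by (rule finite_multiindices_degree_le_1)
  have hs: "(T x has_sum f x) UNIV" if "norm (x - a) < r" for x
    using series[of x] that by (simp add: T_def dist_norm norm_minus_commute)

  have "T (a + u) summable_on UNIV"
    using hs[of "a + u"] u by (auto dest: has_sum_imp_summable)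
  then have "(\<lambda>\<alpha>. norm (T (a + u) \<alpha>)) summable_on UNIV"
    by (rule summable_on_imp_abs_summable_on_euclidean)
  moreover have "norm (T (a + u) \<alpha>) = t ^ sum \<alpha> UNIV * norm (c \<alpha>)" for \<alpha>
    using t by (simp add: T_def u_def power_sum abs_prod power_abs)
  ultimately have "(\<lambda>\<alpha>. t ^ sum \<alpha> UNIV * norm (c \<alpha>)) summable_on UNIV" by simp
  then have "(\<lambda>\<alpha>. t ^ sum \<alpha> UNIV * norm (c \<alpha>)) summable_on -F"
    by (rule summable_on_subset_banach) simp
  then have C: "((\<lambda>\<alpha>. t ^ sum \<alpha> UNIV * norm (c \<alpha>)) has_sum C) (-F)"
    unfolding C_def by (rule has_sum_infsum)

  define P where "P = (\<lambda>x. \<Sum>\<alpha>\<in>F. T x \<alpha>)"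
  have tail: "norm (f x - P x) \<le> (norm (x - a) / t)\<^sup>2 * C" if x: "norm (x - a) < t" for x
  proof (rule norm_infsum_le)
    show "(T x has_sum (f x - P x)) (-F)"
      unfolding Compl_eq_Diff_UNIV
      by (rule has_sum_Diff) (use hs[of x] x tr finF in \<open>auto simp: P_def\<close>)
    show "((\<lambda>\<alpha>. (norm (x - a) / t)\<^sup>2 * (t ^ sum \<alpha> UNIV * norm (c \<alpha>)))
        has_sum (norm (x - a) / t)\<^sup>2 * C) (-F)"
      by (rule has_sum_cmult_right[OF C])
    fix \<alpha> assume "\<alpha> \<in> -F"
    then have deg: "2 \<le> sum \<alpha> UNIV" by (simp add: F_def)
    have "norm (x - a) ^ sum \<alpha> UNIV = (norm (x - a) / t) ^ sum \<alpha> UNIV * t ^ sum \<alpha> UNIV"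
      using t by (simp add: power_divide)
    also have "\<dots> \<le> (norm (x - a) / t)\<^sup>2 * t ^ sum \<alpha> UNIV"
      using t x deg by (intro mult_right_mono power_decreasing) auto
    finally have "\<bar>\<Prod>i\<in>UNIV. (x $ i - a $ i) ^ \<alpha> i\<bar> \<le> (norm (x - a) / t)\<^sup>2 * t ^ sum \<alpha> UNIV"
      using monomial_le_norm_power[of "x - a" \<alpha>] by simp
    from mult_right_mono[OF this norm_ge_zero[of "c \<alpha>"]]
    show "norm (T x \<alpha>) \<le> (norm (x - a) / t)\<^sup>2 * (t ^ sum \<alpha> UNIV * norm (c \<alpha>))"
      by (simp add: T_def mult.assoc)
  qed
  have "f a - P a = 0" using tail[of a] t by simp
  then have "((\<lambda>x. f x - P x) has_derivative (\<lambda>_. 0)) (at a)"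
    using tail
    by (intro has_derivative_zero_of_quadratic_bound[OF t, where K = "C / t\<^sup>2"])
      (simp add: power_divide mult.commute)
  then have "(\<lambda>x. f x - P x) differentiable (at a)"
    by (auto simp: differentiable_def)
  moreover have "P differentiable (at a)"
  proof -
    have comp: "(\<lambda>x :: real ^ 'n. x $ i - a $ i) differentiable (at a)" for i
      by (intro differentiable_diff differentiable_const
          bounded_linear_imp_differentiable bounded_linear_vec_nth)
    have "(\<lambda>x. \<Prod>i\<in>UNIV. (x $ i - a $ i) ^ \<alpha> i) differentiable (at a)" for \<alpha> :: "'n \<Rightarrow> nat"
    proof -
      have "\<exists>D. ((\<lambda>x. (x $ i - a $ i) ^ \<alpha> i) has_derivative D) (at a)" for i
        using differentiable_power[OF comp] by (simp add: differentiable_def)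
      then obtain D where D: "\<And>i. ((\<lambda>x. (x $ i - a $ i) ^ \<alpha> i) has_derivative D i) (at a)"
        by metis
      show ?thesis
        unfolding differentiable_def by (rule exI, rule has_derivative_prod, rule D)
    qed
    then show ?thesis
      unfolding P_def T_def
      by (intro differentiable_sum finF differentiable_scaleR differentiable_const ballI)
  qed
  ultimately have "(\<lambda>x. (f x - P x) + P x) differentiable (at a)"
    by (rule differentiable_add)
  then show ?thesis by simp
qed

lemma real_analytic_on_imp_differentiable:
  assumes "real_analytic_on f S" and "a \<in> S"
  shows "f differentiable (at a)"
  using assms differentiable_of_multivariate_power_series
  unfolding real_analytic_on_def by blast

lemma real_analytic_on_imp_continuous_on:
  "real_analytic_on f S \<Longrightarrow> continuous_on S f"
  by (meson continuous_at_imp_continuous_on differentiable_imp_continuous_within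
      real_analytic_on_imp_differentiable)

section \<open>The maximal contracted ball\<close>

text \<open>With \<open>q\<close> the operator norm of the derivative, the linear approximation is accurate up to
  \<open>(1 - q) / 2 * norm x\<close> near \<open>0\<close>, which leaves the factor \<open>(1 + q) / 2 < 1\<close>.\<close>

lemma norm_decreasing_near_fixpoint:
  fixes f :: "'a::real_normed_vector \<Rightarrow> 'a"
  assumes der: "(f has_derivative D) (at 0)" and "f 0 = 0" and q: "onorm D < 1"
  shows "\<exists>d>0. \<forall>x. norm x < d \<longrightarrow> x \<noteq> 0 \<longrightarrow> norm (f x) < norm x"
proof -
  define e where "e = (1 - onorm D) / 2"
  have "0 < e" using q by (simp add: e_def)
  then obtain d where "0 < d"
    and approx: "\<And>x. norm x < d \<Longrightarrow> norm (f x - D x) \<le> e * norm x"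
    using der \<open>f 0 = 0\<close> unfolding has_derivative_at_alt by (metis diff_zero)
  have "norm (f x) < norm x" if "norm x < d" "x \<noteq> 0" for x
  proof -
    have "norm (f x) \<le> norm (f x - D x) + norm (D x)"
      using norm_triangle_ineq[of "f x - D x" "D x"] by simp
    also have "\<dots> \<le> e * norm x + onorm D * norm x"
      using approx[OF that(1)] onorm[OF has_derivative_bounded_linear[OF der], of x] by simp
    also have "\<dots> = (1 - e) * norm x" by (simp add: e_def field_simps)
    also have "\<dots> < norm x" using \<open>0 < e\<close> that(2) by simp
    finally show ?thesis .
  qed
  with \<open>0 < d\<close> show ?thesis by blast
qed

lemma eball0_Sup: "eball0 (Sup A) = (\<Union>r\<in>A. eball0 r)"
  by (auto simp: eball0_def less_Sup_iff)

text \<open>The supremum of all contraction radii is again one, hence the greatest; without this,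
  \<open>max_contraction_radius\<close> would be an unspecified value.\<close>

lemma contraction_radius_max_contraction_radius:
  assumes "contraction_radius \<Omega> f r"
  shows "contraction_radius \<Omega> f (max_contraction_radius \<Omega> f)"
proof -
  define R where "R = Sup {r. contraction_radius \<Omega> f r}"
  have "r \<le> R" using assms by (auto simp: R_def intro: Sup_upper)
  then have "0 < R" using assms by (auto simp: contraction_radius_def)
  then have "contraction_radius \<Omega> f R"
    by (auto simp: contraction_radius_def R_def eball0_Sup)
  moreover from this have "max_contraction_radius \<Omega> f = R"
    unfolding max_contraction_radius_def
    by (rule Greatest_equality) (simp add: R_def Sup_upper)
  ultimately show ?thesis by simp
qed

section \<open>Orbits of norm-decreasing maps\<close>

text \<open>A positive limit \<open>L\<close> of the norms would keep the orbit in the compact shell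
  \<open>L \<le> norm y \<le> norm x\<close>. There continuity and compactness turn the strict decrease into a
  decrease by a fixed amount, which is incompatible with the convergence of the norms.\<close>

lemma iterates_tendsto_0_of_norm_decreasing:
  fixes f :: "'a::{heine_borel, real_normed_vector} \<Rightarrow> 'a"
  assumes cont: "continuous_on (cball 0 (norm x)) f" and "f 0 = 0"
    and dec: "\<And>y. norm y \<le> norm x \<Longrightarrow> y \<noteq> 0 \<Longrightarrow> norm (f y) < norm y"
  shows "(\<lambda>k. (f ^^ k) x) \<longlonglongrightarrow> 0"
proof -
  define n where "n = (\<lambda>k. norm ((f ^^ k) x))"
  have dec': "norm (f y) \<le> norm y" if "norm y \<le> norm x" for y
    using dec[OF that] \<open>f 0 = 0\<close> by (cases "y = 0") auto
  have bound: "n k \<le> norm x" for k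
  proof (induction k)
    case (Suc k)
    then show ?case using dec'[of "(f ^^ k) x"] by (simp add: n_def)
  qed (simp add: n_def)
  have step: "n (Suc k) \<le> n k" for k
    using dec'[of "(f ^^ k) x"] bound[of k] by (simp add: n_def)
  then have "decseq n" by (simp add: decseq_Suc_iff)
  then obtain L where L: "n \<longlonglongrightarrow> L" and Ln: "\<And>k. L \<le> n k"
    using decseq_convergent[of n 0] by (auto simp: n_def)
  have "L = 0"
  proof (rule ccontr)
    assume "L \<noteq> 0"
    moreover have "0 \<le> L" by (rule LIMSEQ_le_const[OF L]) (simp add: n_def)
    ultimately have "0 < L" by simp
    define K where "K = cball 0 (norm x) \<inter> {y :: 'a. L \<le> norm y}"
    have orbit: "(f ^^ k) x \<in> K" for k
      using bound[of k] Ln[of k] by (simp add: K_def n_def)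
    then have "K \<noteq> {}" by blast
    moreover have "compact K"
      unfolding K_def by (intro compact_Int_closed compact_cball closed_Collect_le continuous_intros)
    moreover have "continuous_on K (\<lambda>y. norm y - norm (f y))"
      by (intro continuous_intros continuous_on_subset[OF cont]) (auto simp: K_def)
    ultimately obtain z where z: "z \<in> K"
      and zmin: "\<And>y. y \<in> K \<Longrightarrow> norm z - norm (f z) \<le> norm y - norm (f y)"
      using continuous_attains_inf[of K "\<lambda>y. norm y - norm (f y)"] by blast
    have "norm z - norm (f z) \<le> n k - n (Suc k)" for k
      using zmin[OF orbit[of k]] by (simp add: n_def)
    moreover have "(\<lambda>k. n k - n (Suc k)) \<longlonglongrightarrow> L - L"
      by (intro tendsto_diff L LIMSEQ_Suc[OF L])
    ultimately have "norm z - norm (f z) \<le> 0"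
      by (intro LIMSEQ_le_const) auto
    moreover have "norm (f z) < norm z"
      using z \<open>0 < L\<close> by (intro dec) (auto simp: K_def)
    ultimately show False by simp
  qed
  with L show ?thesis by (simp add: n_def tendsto_norm_zero_iff)
qed

section \<open>Exhaustion of the domain of attraction\<close>

theorem theorem2p9:
  fixes \<Omega> :: "(real ^ 'n) set" and f :: "real ^ 'n \<Rightarrow> real ^ 'n"
  assumes "open \<Omega>" and "connected \<Omega>" and "0 \<in> \<Omega>"
    and "f \<in> \<Omega> \<rightarrow> \<Omega>"
    and "real_analytic_on f \<Omega>"
    and "f 0 = 0"
    and "onorm (\<lambda>v. jacobian f (at 0) *v v) < 1"
  shows "(\<forall>p. preimage_ball \<Omega> f p \<subseteq> domain_of_attraction \<Omega> f) \<and>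
    (\<forall>p. f ` preimage_ball \<Omega> f p \<subseteq> preimage_ball \<Omega> f p) \<and>
    (\<forall>p. preimage_ball \<Omega> f p \<subseteq> preimage_ball \<Omega> f (Suc p)) \<and>
    (\<forall>x \<in> domain_of_attraction \<Omega> f. \<exists>p. x \<in> preimage_ball \<Omega> f p)"
proof -
  have cont: "continuous_on \<Omega> f"
    using assms(5) by (rule real_analytic_on_imp_continuous_on)
  have "(f has_derivative (\<lambda>v. jacobian f (at 0) *v v)) (at 0)"
    using real_analytic_on_imp_differentiable[OF assms(5,3)] by (simp add: jacobian_works)
  from norm_decreasing_near_fixpoint[OF this assms(6,7)]
  obtain d where d: "0 < d" "\<And>x. norm x < d \<Longrightarrow> x \<noteq> 0 \<Longrightarrow> norm (f x) < norm x"
    by blast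
  obtain e where e: "0 < e" "ball 0 e \<subseteq> \<Omega>"
    using assms(1,3) open_contains_ball by blast
  have "contraction_radius \<Omega> f (ereal (min d e))"
    unfolding contraction_radius_def eball0_def using d e by (auto simp: subset_iff)
  define R where "R = max_contraction_radius \<Omega> f"
  have "contraction_radius \<Omega> f R"
    unfolding R_def by (rule contraction_radius_max_contraction_radius) fact
  then have R: "0 < R" "eball0 R \<subseteq> \<Omega>"
    and dec: "\<And>x. x \<in> eball0 R \<Longrightarrow> x \<noteq> 0 \<Longrightarrow> norm (f x) < norm x"
    by (auto simp: contraction_radius_def)
  have M: "x \<in> preimage_ball \<Omega> f p \<longleftrightarrow> x \<in> \<Omega> \<and> (f ^^ p) x \<in> eball0 R" for x p
    by (simp add: preimage_ball_def R_def)
  have down: "y \<in> eball0 R" if "x \<in> eball0 R" "norm y \<le> norm x" for x y :: "real ^ 'n"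
    using that le_less_trans[of "ereal (norm y)" "ereal (norm x)" R] by (simp add: eball0_def)
  have inv: "f x \<in> eball0 R" if "x \<in> eball0 R" for x
    using down[OF that, of "f x"] dec[OF that] that \<open>f 0 = 0\<close> by (cases "x = 0") auto

  have "x \<in> domain_of_attraction \<Omega> f" if x: "x \<in> preimage_ball \<Omega> f p" for x p
  proof -
    let ?y = "(f ^^ p) x"
    have y: "?y \<in> eball0 R" using x M by blast
    have "(\<lambda>k. (f ^^ k) ?y) \<longlonglongrightarrow> 0"
    proof (rule iterates_tendsto_0_of_norm_decreasing)
      show "continuous_on (cball 0 (norm ?y)) f"
        by (rule continuous_on_subset[OF cont]) (use down[OF y] R in auto)
    qed (use \<open>f 0 = 0\<close> dec down[OF y] in auto)
    then have "(\<lambda>k. (f ^^ (k + p)) x) \<longlonglongrightarrow> 0" by (simp add: funpow_add)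
    then have "(\<lambda>k. (f ^^ k) x) \<longlonglongrightarrow> 0" by (rule LIMSEQ_offset)
    then show ?thesis using x M by (simp add: domain_of_attraction_def)
  qed
  moreover have "f x \<in> preimage_ball \<Omega> f p" if "x \<in> preimage_ball \<Omega> f p" for x p
    using that assms(4) inv[of "(f ^^ p) x"] by (auto simp: M funpow_swap1)
  moreover have "x \<in> preimage_ball \<Omega> f (Suc p)" if "x \<in> preimage_ball \<Omega> f p" for x p
    using that inv by (simp add: M)
  moreover have "\<exists>p. x \<in> preimage_ball \<Omega> f p" if x: "x \<in> domain_of_attraction \<Omega> f" for x
  proof -
    have "(\<lambda>k. ereal (norm ((f ^^ k) x))) \<longlonglongrightarrow> ereal (norm (0 :: real ^ 'n))"
      using x by (intro tendsto_intros) (simp add: domain_of_attraction_def)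
    then have "\<forall>\<^sub>F k in sequentially. ereal (norm ((f ^^ k) x)) < R"
      by (rule order_tendstoD) (use R in \<open>simp add: zero_ereal_def\<close>)
    then obtain p where "ereal (norm ((f ^^ p) x)) < R"
      by (auto simp: eventually_sequentially)
    then show ?thesis using x by (auto simp: M eball0_def domain_of_attraction_def)
  qed
  ultimately show ?thesis by blast
qed

end
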